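(* Consider a left-invariant Lorentzian problem on $G=\mathrm{Aff}_+(\mathbb R)$ given by a matrix $A=\begin{pmatrix}a&b\\c&d\end{pmatrix}$, $|A|>0$. For every $q_0\in G$, $$J^+(q_0)=q_0\exp(\mathcal U)=\{q\in G:\ \lambda_1(q)\le\lambda_1(q_0),\ \lambda_2(q)\ge\lambda_2(q_0)\},$$ $$J^-(q_0)=q_0\exp(-\mathcal U)=\{q\in G:\ \lambda_1(q)\ge\lambda_1(q_0),\ \lambda_2(q)\le\lambda_2(q_0)\},$$ where $\exp:\mathfrak g\to G$ is the exponential mapping of the Lie group $G$. Moreover, $I^+(q_0)=\{q_0\}\cup\operatorname{int}J^+(q_0)$ and $I^-(q_0)=\{q_0\}\cup\operatorname{int}J^-(q_0)$.
   Context: $G=\mathrm{Aff}_+(\mathbb R)=\{(x,y)\in\mathbb R^2: y>0\}$ with product $(x_2,y_2)\cdot(x_1,y_1)=(x_2+y_2x_1,\,y_2y_1)$ and identity $\mathrm{Id}=(0,1)$; left-invariant frame $X_1=y\,\partial_x$, $X_2=y\,\partial_y$; $\mathfrak g=\operatorname{span}(X_1,X_2)$. The Lie group exponential is $\exp(u_1X_1+u_2X_2)=\left(\frac{u_1}{u_2}(e^{u_2}-1),e^{u_2}\right)$ for $u_2\ne0$ and $\exp(u_1X_1)=(u_1,1)$. A real matrix $A=\begin{pmatrix}a&b\\c&d\end{pmatrix}$ with $|A|=ad-bc>0$ determines the left-invariant Lorentzian form $g(u_1X_1+u_2X_2)=-v_1^2+v_2^2$, where $v_1=au_1+bu_2$,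 $v_2=cu_1+du_2$, with time orientation in which the future directed nonspacelike vectors are those with $v_1\ge|v_2|$ and the future directed timelike ones are those with $v_1>|v_2|$ (past directed vectors are the negatives). The cone of admissible velocities is $\mathcal U=\{u_1X_1+u_2X_2: v_1\ge|v_2|\}\subset\mathfrak g$. $J^+(q_0)$ (resp. $J^-(q_0)$) is the set of points $q_1\in G$ reachable from $q_0$ by Lipschitz curves $q:[0,t_1]\to G$, $t_1\ge0$, whose velocity is a.e. future (resp. past) directed nonspacelike; $I^{\pm}(q_0)$ are defined in the same way with future/past directed timelike curves, the trivial curve ($t_1=0$) being allowed. $\lambda_1(x,y)=(c-a)x+(d-b)(y-1)$, $\lambda_2(x,y)=(c+a)x+(d+b)(y-1)$. *)

theory Defs
  imports "HOL-Analysis.Analysis"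
begin

text \<open>
  Points of the group are pairs \<open>(x, y)\<close> of reals, as are tangent vectors, in the coordinates
  \<open>\<partial>\<^sub>x, \<partial>\<^sub>y\<close>. Elements of the Lie algebra are vectors in \<open>real^2\<close>: the coordinates \<open>(u\<^sub>1, u\<^sub>2)\<close>
  with respect to the left-invariant frame \<open>X\<^sub>1, X\<^sub>2\<close>.
  The group is an open half-plane, so interiors in the plane of its subsets are interiors in it.
\<close>

definition Aff :: "(real \<times> real) set"
  where "Aff = {(x, y). 0 < y}"

definition aff_mult :: "real \<times> real \<Rightarrow> real \<times> real \<Rightarrow> real \<times> real"
  where "aff_mult p q = (fst p + snd p * fst q, snd p * snd q)"

definition aff_one :: "real \<times> real"
  where "aff_one = (0, 1)"

definition X1 :: "real \<times> real \<Rightarrow> real \<times> real"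
  where "X1 q = (snd q, 0)"

definition X2 :: "real \<times> real \<Rightarrow> real \<times> real"
  where "X2 q = (0, snd q)"

definition lie_field :: "real^2 \<Rightarrow> real \<times> real \<Rightarrow> real \<times> real"
  where "lie_field u q = u $ 1 *\<^sub>R X1 q + u $ 2 *\<^sub>R X2 q"

lemma lie_field_left_invariant:
  "(aff_mult p has_derivative (\<lambda>h. snd p *\<^sub>R h)) (at q)"
  "lie_field u (aff_mult p q) = snd p *\<^sub>R lie_field u q"
proof -
  have "((\<lambda>q. (fst p + snd p * fst q, snd p * snd q)) has_derivative (\<lambda>h. snd p *\<^sub>R h)) (at q)"
    by (auto intro!: derivative_eq_intros simp: scaleR_prod_def)
  then show "(aff_mult p has_derivative (\<lambda>h. snd p *\<^sub>R h)) (at q)"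
    by (simp add: aff_mult_def[abs_def])
  show "lie_field u (aff_mult p q) = snd p *\<^sub>R lie_field u q"
    by (simp add: lie_field_def aff_mult_def X1_def X2_def)
qed

definition is_one_param :: "real^2 \<Rightarrow> (real \<Rightarrow> real \<times> real) \<Rightarrow> bool"
  where "is_one_param u \<gamma> \<longleftrightarrow> \<gamma> 0 = aff_one \<and>
    (\<forall>t. \<gamma> t \<in> Aff \<and> (\<gamma> has_vector_derivative lie_field u (\<gamma> t)) (at t))"

text \<open>
  The Lie group exponential: the value at time 1 of the integral curve through the identity of
  the left-invariant field \<open>u\<^sub>1 X\<^sub>1 + u\<^sub>2 X\<^sub>2\<close>. Existence and uniqueness of the curve, and the closed
  formula, are proved below.
\<close>

definition aff_exp :: "real^2 \<Rightarrow> real \<times> real"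
  where "aff_exp u = (THE \<gamma>. is_one_param u \<gamma>) 1"

lemma is_one_param_iff:
  "is_one_param u \<gamma> \<longleftrightarrow>
    \<gamma> = (\<lambda>t. if u $ 2 = 0 then (t * u $ 1, 1)
             else (u $ 1 / u $ 2 * (exp (t * u $ 2) - 1), exp (t * u $ 2)))"
  (is "_ \<longleftrightarrow> \<gamma> = ?g")
proof
  assume *: "is_one_param u \<gamma>"
  have d: "(\<gamma> has_vector_derivative (u $ 1 * snd (\<gamma> t), u $ 2 * snd (\<gamma> t))) (at t)" for t
    using * by (simp add: is_one_param_def lie_field_def X1_def X2_def)
  have dx: "((\<lambda>t. fst (\<gamma> t)) has_real_derivative u $ 1 * snd (\<gamma> t)) (at t)" for t
    using bounded_linear.has_vector_derivative[OF bounded_linear_fst d[of t]]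
    by (simp add: has_real_derivative_iff_has_vector_derivative)
  have dy: "((\<lambda>t. snd (\<gamma> t)) has_real_derivative u $ 2 * snd (\<gamma> t)) (at t)" for t
    using bounded_linear.has_vector_derivative[OF bounded_linear_snd d[of t]]
    by (simp add: has_real_derivative_iff_has_vector_derivative)
  have init: "fst (\<gamma> 0) = 0" "snd (\<gamma> 0) = 1"
    using * by (auto simp: is_one_param_def aff_one_def)
  have "((\<lambda>t. snd (\<gamma> t) * exp (- (t * u $ 2))) has_real_derivative 0) (at t)" for t
    by (auto intro!: derivative_eq_intros dy simp: algebra_simps)
  then have "snd (\<gamma> t) * exp (- (t * u $ 2)) = snd (\<gamma> 0) * exp (- (0 * u $ 2))" for t
    by (rule DERIV_isconst_all[rule_format, of "\<lambda>t. snd (\<gamma> t) * exp (- (t * u $ 2))"])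
  then have y: "snd (\<gamma> t) = exp (t * u $ 2)" for t
    by (simp add: init exp_minus field_simps)
  have "((\<lambda>t. fst (\<gamma> t) - fst (?g t)) has_real_derivative 0) (at t)" for t
    by (cases "u $ 2 = 0") (auto intro!: derivative_eq_intros dx simp: y)
  then have c: "fst (\<gamma> t) - fst (?g t) = fst (\<gamma> 0) - fst (?g 0)" for t
    by (rule DERIV_isconst_all[rule_format, of "\<lambda>t. fst (\<gamma> t) - fst (?g t)"])
  have x: "fst (\<gamma> t) = fst (?g t)" for t
    using c[of t] by (cases "u $ 2 = 0") (auto simp: init)
  show "\<gamma> = ?g"
  proof
    fix t show "\<gamma> t = ?g t"
      using x[of t] y[of t] by (cases "u $ 2 = 0") (auto simp: prod_eq_iff)
  qed
next
  assume g: "\<gamma> = ?g"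
  show "is_one_param u \<gamma>"
  proof (cases "u $ 2 = 0")
    case True
    have "((\<lambda>t. (t * u $ 1, 1::real)) has_vector_derivative (u $ 1, 0)) (at t)" for t :: real
      by (rule has_vector_derivative_Pair) (auto intro!: derivative_eq_intros)
    then show ?thesis
      using True by (simp add: g is_one_param_def aff_one_def Aff_def lie_field_def X1_def X2_def)
  next
    case False
    have "((\<lambda>t. (u $ 1 / u $ 2 * (exp (t * u $ 2) - 1), exp (t * u $ 2)))
      has_vector_derivative (u $ 1 * exp (t * u $ 2), u $ 2 * exp (t * u $ 2))) (at t)" for t :: real
      by (rule has_vector_derivative_Pair)
        (use False in \<open>auto intro!: derivative_eq_intros
          simp flip: has_real_derivative_iff_has_vector_derivative\<close>)
    then show ?thesis
      using False by (simp add: g is_one_param_def aff_one_def Aff_def lie_field_def X1_def X2_def)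
  qed
qed

lemma aff_exp_formula:
  "aff_exp u = (if u $ 2 = 0 then (u $ 1, 1)
                else (u $ 1 / u $ 2 * (exp (u $ 2) - 1), exp (u $ 2)))"
  by (simp add: aff_exp_def is_one_param_iff)

text \<open>Here \<open>A *v u\<close> is the vector \<open>(v\<^sub>1, v\<^sub>2)\<close> with \<open>v\<^sub>1 = a u\<^sub>1 + b u\<^sub>2\<close> and \<open>v\<^sub>2 = c u\<^sub>1 + d u\<^sub>2\<close>.\<close>

definition lorentz_form :: "real^2^2 \<Rightarrow> real^2 \<Rightarrow> real"
  where "lorentz_form A u = - ((A *v u) $ 1)\<^sup>2 + ((A *v u) $ 2)\<^sup>2"

definition future_nonspacelike :: "real^2^2 \<Rightarrow> (real^2) set"
  where "future_nonspacelike A = {u. (A *v u) $ 1 \<ge> \<bar>(A *v u) $ 2\<bar>}"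

definition future_timelike :: "real^2^2 \<Rightarrow> (real^2) set"
  where "future_timelike A = {u. (A *v u) $ 1 > \<bar>(A *v u) $ 2\<bar>}"

lemma future_nonspacelike_iff:
  "u \<in> future_nonspacelike A \<longleftrightarrow> lorentz_form A u \<le> 0 \<and> (A *v u) $ 1 \<ge> 0"
  by (auto simp: future_nonspacelike_def lorentz_form_def simp flip: abs_le_square_iff)

lemma future_timelike_iff:
  "u \<in> future_timelike A \<longleftrightarrow> lorentz_form A u < 0 \<and> (A *v u) $ 1 > 0"
proof -
  have "\<bar>y\<bar> < x \<longleftrightarrow> y\<^sup>2 < x\<^sup>2 \<and> 0 < x" for x y :: real
    using abs_le_square_iff[of x y] by auto
  then show ?thesis
    by (simp add: future_timelike_def lorentz_form_def)
qed

text \<open>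
  The Lipschitz condition refers to the Euclidean distance of the plane; on the compact image of
  a curve this is equivalent to the Lipschitz condition for any Riemannian distance on the group.
  For \<open>T = 0\<close> the condition on the velocity is vacuous, so the trivial curve is always admitted.
\<close>

definition admissible_curve :: "(real^2) set \<Rightarrow> real \<Rightarrow> (real \<Rightarrow> real \<times> real) \<Rightarrow> bool"
  where "admissible_curve K T q \<longleftrightarrow>
    0 \<le> T \<and> q ` {0..T} \<subseteq> Aff \<and> (\<exists>L. L-lipschitz_on {0..T} q) \<and>
    (AE t in lebesgue. t \<in> {0..T} \<longrightarrow>
      (\<exists>u\<in>K. (q has_vector_derivative lie_field u (q t)) (at t within {0..T})))"

definition reachable :: "(real^2) set \<Rightarrow> real \<times> real \<Rightarrow> (real \<times> real) set"
  where "reachable K q0 = {q1. \<exists>T q. admissible_curve K T q \<and> q 0 = q0 \<and> q T = q1}"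

definition J_plus :: "real^2^2 \<Rightarrow> real \<times> real \<Rightarrow> (real \<times> real) set"
  where "J_plus A q0 = reachable (future_nonspacelike A) q0"

definition J_minus :: "real^2^2 \<Rightarrow> real \<times> real \<Rightarrow> (real \<times> real) set"
  where "J_minus A q0 = reachable (uminus ` future_nonspacelike A) q0"

definition I_plus :: "real^2^2 \<Rightarrow> real \<times> real \<Rightarrow> (real \<times> real) set"
  where "I_plus A q0 = reachable (future_timelike A) q0"

definition I_minus :: "real^2^2 \<Rightarrow> real \<times> real \<Rightarrow> (real \<times> real) set"
  where "I_minus A q0 = reachable (uminus ` future_timelike A) q0"

definition lambda1 :: "real^2^2 \<Rightarrow> real \<times> real \<Rightarrow> real"
  where "lambda1 A q = (A $ 2 $ 1 - A $ 1 $ 1) * fst q + (A $ 2 $ 2 - A $ 1 $ 2) * (snd q - 1)"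

definition lambda2 :: "real^2^2 \<Rightarrow> real \<times> real \<Rightarrow> real"
  where "lambda2 A q = (A $ 2 $ 1 + A $ 1 $ 1) * fst q + (A $ 2 $ 2 + A $ 1 $ 2) * (snd q - 1)"

end

theory Submission
  imports Defs
begin

text \<open>
  The field \<open>u\<^sub>1 X\<^sub>1 + u\<^sub>2 X\<^sub>2\<close> at \<open>(x, y)\<close> is the constant vector \<open>(u\<^sub>1, u\<^sub>2)\<close> multiplied by \<open>y > 0\<close>.
  So the cone field of a left-invariant cone is, up to positive factors which a cone does not
  notice, the field of parallel cones of the affine plane, and the problem is that of a constant
  cone of the Minkowski plane restricted to the convex half-plane \<open>y > 0\<close>.

  Two consequences carry the proof. First, one-parameter subgroups and their left translates run
  along straight lines. As the half-plane is convex, each of its points \<open>q\<close> is joined to \<open>q\<^sub>0\<close> by a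
  segment of such a line. Hence, for a cone \<open>K\<close>, the set \<open>q\<^sub>0 exp(K)\<close> consists of the points \<open>q\<close> of the
  half-plane with \<open>q - q\<^sub>0 \<in> K\<close> (\<open>left_translate_exp_cone\<close>), and all these points are reachable
  (\<open>reachable_if_displacement_in_cone\<close>). Second, \<open>\<lambda>\<^sub>1\<close> and \<open>\<lambda>\<^sub>2\<close> are affine
  functions whose derivatives along a velocity with coordinates \<open>v = A u\<close> are \<open>y (v\<^sub>2 - v\<^sub>1)\<close> and
  \<open>y (v\<^sub>2 + v\<^sub>1)\<close>. These have constant signs on the cone, so \<open>\<lambda>\<^sub>1\<close> decreases and \<open>\<lambda>\<^sub>2\<close> increases along
  every admissible curve, which confines the points reachable by nonspacelike curves to the same set.

  The analytic point is that a Lipschitz function whose derivative is nonpositive (negative) almost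
  everywhere is nonincreasing (strictly decreasing). For timelike curves the strict version yields the
  strict inequalities, which describe the interior because \<open>\<lambda>\<^sub>1\<close> and \<open>\<lambda>\<^sub>2\<close> are nonconstant when
  \<open>|A| \<noteq> 0\<close>. The past of \<open>A\<close> is the future of \<open>- A\<close>, which has the same determinant.
\<close>

section \<open>Lipschitz functions with a derivative of one sign almost everywhere\<close>

text \<open>
  A Lipschitz function maps null sets to null sets. Were \<open>f a < f b\<close>, some level strictly between
  these values would thus be attained only at points where the derivative is negative; but at the
  last point where \<open>f\<close> has this level, \<open>f\<close> is larger everywhere to the right.
\<close>

lemma lipschitz_nonincreasing_if_deriv_neg_ae:
  fixes f :: "real \<Rightarrow> real"
  assumes "a \<le> b" and lip: "L-lipschitz_on {a..b} f" and N: "negligible N"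
    and neg: "\<And>x. x \<in> {a..b} - N \<Longrightarrow> \<exists>l<0. (f has_real_derivative l) (at x within {a..b})"
  shows "f b \<le> f a"
proof (rule ccontr)
  assume "\<not> f b \<le> f a"
  then have less: "f a < f b" by simp
  have cont: "continuous_on {a..b} f"
    using lip by (rule lipschitz_on_continuous_on)
  have "negligible (f ` (N \<inter> {a..b}))"
  proof (rule negligible_locally_Lipschitz_image)
    show "negligible (N \<inter> {a..b})"
      using N by (rule negligible_subset) auto
    fix x assume x: "x \<in> N \<inter> {a..b}"
    show "\<exists>T B. open T \<and> x \<in> T \<and> (\<forall>y\<in>(N \<inter> {a..b}) \<inter> T. norm (f y - f x) \<le> B * norm (y - x))"
      using x lipschitz_onD[OF lip] by (intro exI[of _ UNIV] exI[of _ L]) (auto simp: dist_norm)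
  qed simp
  moreover have "\<not> negligible {f a<..<f b}"
    using less by (simp add: open_not_negligible)
  ultimately obtain c where c: "f a < c" "c < f b" "c \<notin> f ` (N \<inter> {a..b})"
    using negligible_subset[of "f ` (N \<inter> {a..b})" "{f a<..<f b}"]
    by (meson greaterThanLessThan_iff subsetI)
  let ?S = "{a..b} \<inter> f -` {c}"
  have "compact ?S"
    using continuous_closed_preimage[OF cont closed_atLeastAtMost closed_singleton, of c]
    by (auto simp: compact_eq_bounded_closed intro: bounded_subset[OF bounded_closed_interval])
  moreover have "?S \<noteq> {}"
    using IVT'[of f a c b] c \<open>a \<le> b\<close> cont by auto
  ultimately obtain s where s: "s \<in> ?S" "\<And>x. x \<in> ?S \<Longrightarrow> x \<le> s"
    using compact_attains_sup[of ?S] by blast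
  have above: "c < f y" if "s < y" "y \<le> b" for y
  proof (rule ccontr)
    assume "\<not> c < f y"
    moreover have "continuous_on {y..b} f"
      using that s(1) by (intro continuous_on_subset[OF cont]) auto
    ultimately obtain x where "y \<le> x" "x \<le> b" "f x = c"
      using IVT'[of f y c b] c(2) \<open>y \<le> b\<close> by auto
    then show False
      using s(2)[of x] s(1) that by auto
  qed
  have "s \<notin> N"
    using s(1) c(3) by auto
  then obtain l where "l < 0" "(f has_real_derivative l) (at s within {a..b})"
    using neg[of s] s(1) by auto
  then obtain d where d: "0 < d" "\<And>h. 0 < h \<Longrightarrow> s + h \<in> {a..b} \<Longrightarrow> h < d \<Longrightarrow> f (s + h) < f s"
    using has_real_derivative_neg_dec_right by blast
  have "s < b"
    using s(1) c(2) by (cases "s = b") auto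
  define h where "h = min (d / 2) (b - s)"
  have "0 < h" "h < d" "s + h \<le> b"
    using d(1) \<open>s < b\<close> by (auto simp: h_def min_def)
  then show False
    using d(2)[of h] above[of "s + h"] s(1) by auto
qed

lemma lipschitz_nonincreasing_if_deriv_nonpos_ae:
  fixes f :: "real \<Rightarrow> real"
  assumes "a \<le> b" and lip: "L-lipschitz_on {a..b} f" and N: "negligible N"
    and nonpos: "\<And>x. x \<in> {a..b} - N \<Longrightarrow> \<exists>l\<le>0. (f has_real_derivative l) (at x within {a..b})"
  shows "f b \<le> f a"
proof (rule field_le_epsilon)
  fix e :: real assume "0 < e"
  \<comment> \<open>A small negative slope is added; the total loss over the interval stays below \<open>e\<close>.\<close>
  define k where "k = e / (b - a + 1)"
  have k: "0 < k" "k * (b - a) \<le> e"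
    using \<open>0 < e\<close> \<open>a \<le> b\<close> by (auto simp: k_def field_simps)
  have "f b - k * b \<le> f a - k * a"
  proof (rule lipschitz_nonincreasing_if_deriv_neg_ae[where f = "\<lambda>x. f x - k * x", OF \<open>a \<le> b\<close> _ N])
    have "k-lipschitz_on {a..b} (\<lambda>x. k * x)"
      using k(1) by (intro lipschitz_onI) (auto simp: dist_real_def abs_mult simp flip: right_diff_distrib)
    then show "(L + k)-lipschitz_on {a..b} (\<lambda>x. f x - k * x)"
      using lip by (intro lipschitz_on_diff)
    fix x assume "x \<in> {a..b} - N"
    then obtain l where l: "l \<le> 0" "(f has_real_derivative l) (at x within {a..b})"
      using nonpos by blast
    then show "\<exists>l<0. ((\<lambda>x. f x - k * x) has_real_derivative l) (at x within {a..b})"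
      using k(1) by (intro exI[of _ "l - k"]) (auto intro!: derivative_eq_intros)
  qed
  then show "f b \<le> f a + e"
    using k(2) by (simp add: algebra_simps)
qed

text \<open>
  A nonincreasing function with \<open>f a = f b\<close> is constant, so that its derivative vanishes at a point
  where it is supposed to be negative.
\<close>

lemma lipschitz_decreasing_if_deriv_neg_ae:
  fixes f :: "real \<Rightarrow> real"
  assumes "a < b" and lip: "L-lipschitz_on {a..b} f" and N: "negligible N"
    and neg: "\<And>x. x \<in> {a..b} - N \<Longrightarrow> \<exists>l<0. (f has_real_derivative l) (at x within {a..b})"
  shows "f b < f a"
proof -
  have mono: "f y \<le> f x" if "a \<le> x" "x \<le> y" "y \<le> b" for x y
  proof (rule lipschitz_nonincreasing_if_deriv_neg_ae[OF \<open>x \<le> y\<close> _ N])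
    show "L-lipschitz_on {x..y} f"
      using lip by (rule lipschitz_on_subset) (use that in auto)
    fix t assume "t \<in> {x..y} - N"
    then show "\<exists>l<0. (f has_real_derivative l) (at t within {x..y})"
      using neg[of t] that by (meson DERIV_subset DiffD1 DiffD2 DiffI atLeastatMost_subset_iff subsetD)
  qed
  have "\<not> negligible {a<..<b}"
    using \<open>a < b\<close> by (simp add: open_not_negligible)
  then obtain x where x: "a < x" "x < b" "x \<notin> N"
    using negligible_subset[OF N, of "{a<..<b}"] by (meson greaterThanLessThan_iff subsetI)
  then obtain l where "l < 0" "(f has_real_derivative l) (at x within {a..b})"
    using neg[of x] by auto
  then obtain d where d: "0 < d" "\<And>h. 0 < h \<Longrightarrow> x + h \<in> {a..b} \<Longrightarrow> h < d \<Longrightarrow> f (x + h) < f x"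
    using has_real_derivative_neg_dec_right by blast
  define h where "h = min (d / 2) (b - x)"
  have h: "0 < h" "h < d" "x + h \<le> b"
    using d(1) x by (auto simp: h_def min_def)
  have "f b \<le> f (x + h)" "f (x + h) < f x" "f x \<le> f a"
    using mono[of "x + h" b] mono[of a x] d(2)[of h] h x by auto
  then show ?thesis by simp
qed

section \<open>Left-invariant cones are parallel\<close>

definition displacement :: "real \<times> real \<Rightarrow> real \<times> real \<Rightarrow> real^2"
  where "displacement q0 q = vector [fst q - fst q0, snd q - snd q0]"

lemma Aff_iff: "q \<in> Aff \<longleftrightarrow> 0 < snd q"
  by (simp add: Aff_def case_prod_beta)

lemma lie_field_eq: "lie_field u q = snd q *\<^sub>R (u $ 1, u $ 2)"
  by (simp add: lie_field_def X1_def X2_def)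

lemma displacement_add: "displacement q (q + r *\<^sub>R (u $ 1, u $ 2)) = r *\<^sub>R u"
  by (simp add: displacement_def vec_eq_iff forall_2)

text \<open>Left translates of one-parameter subgroups run along straight lines.\<close>

lemma left_translate_exp_eq:
  assumes "q0 \<in> Aff"
  obtains r where "0 < r" "aff_mult q0 (aff_exp u) = q0 + r *\<^sub>R (u $ 1, u $ 2)"
proof (cases "u $ 2 = 0")
  case True
  then show ?thesis
    using assms by (intro that[of "snd q0"]) (auto simp: Aff_def aff_exp_formula aff_mult_def prod_eq_iff)
next
  case False
  have "0 < (exp (u $ 2) - 1) / u $ 2"
    using False by (cases "0 < u $ 2") (auto intro!: divide_neg_neg)
  then have "0 < snd q0 * ((exp (u $ 2) - 1) / u $ 2)"
    using assms unfolding Aff_iff by (intro mult_pos_pos)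
  then show ?thesis
    by (rule that) (use False in \<open>auto simp: aff_exp_formula aff_mult_def prod_eq_iff field_simps\<close>)
qed

lemma left_translate_exp_surj:
  assumes "q0 \<in> Aff" "q \<in> Aff"
  obtains r where "0 < r" "aff_mult q0 (aff_exp (r *\<^sub>R displacement q0 q)) = q"
proof -
  obtain x0 y0 x y where q: "q0 = (x0, y0)" "q = (x, y)"
    by (metis surj_pair)
  have pos: "0 < y0" "0 < y"
    using assms by (auto simp: q Aff_def)
  show ?thesis
  proof (cases "y = y0")
    case True
    then show ?thesis
      using pos by (intro that[of "1 / y0"])
        (auto simp: q displacement_def aff_exp_formula aff_mult_def)
  next
    case False
    define r where "r = ln (y / y0) / (y - y0)"
    have ln: "ln (y / y0) \<noteq> 0" "exp (ln (y / y0)) = y / y0"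
      using pos False by auto
    have "0 < r"
      using pos False unfolding r_def
      by (cases "y0 < y") (auto intro!: divide_pos_pos divide_neg_neg simp: ln_gt_zero ln_less_zero)
    have r: "r * (y - y0) = ln (y / y0)"
      using False by (simp add: r_def)
    have "r * (x - x0) / ln (y / y0) = (x - x0) / (y - y0)"
      using ln False by (simp add: r_def)
    then have "aff_mult q0 (aff_exp (r *\<^sub>R displacement q0 q)) = q"
      using pos False ln
      by (simp add: q displacement_def aff_exp_formula aff_mult_def r) (simp add: field_simps)
    then show ?thesis
      using \<open>0 < r\<close> that by blast
  qed
qed

lemma left_translate_exp_cone:
  assumes "q0 \<in> Aff" and cone: "\<And>r u. 0 < r \<Longrightarrow> u \<in> K \<Longrightarrow> r *\<^sub>R u \<in> K"
  shows "aff_mult q0 ` aff_exp ` K = {q \<in> Aff. displacement q0 q \<in> K}"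
proof (intro subset_antisym subsetI)
  fix q assume "q \<in> aff_mult q0 ` aff_exp ` K"
  then obtain u where u: "u \<in> K" "q = aff_mult q0 (aff_exp u)" by auto
  have "q \<in> Aff"
    using \<open>q0 \<in> Aff\<close> by (auto simp: u Aff_def aff_mult_def aff_exp_formula)
  moreover have "displacement q0 q \<in> K"
    using left_translate_exp_eq[OF \<open>q0 \<in> Aff\<close>, of u] u cone by (metis displacement_add)
  ultimately show "q \<in> {q \<in> Aff. displacement q0 q \<in> K}" by simp
next
  fix q assume "q \<in> {q \<in> Aff. displacement q0 q \<in> K}"
  then show "q \<in> aff_mult q0 ` aff_exp ` K"
    using left_translate_exp_surj[OF \<open>q0 \<in> Aff\<close>, of q] cone by (metis (lifting) imageI mem_Collect_eq)
qed

text \<open>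
  The uniformly parametrised segment from \<open>q0\<close> to \<open>q\<close> is admissible: its constant velocity is, at a
  point of ordinate \<open>y\<close>, the value of the left-invariant field of coordinates \<open>(q - q0) / y\<close>.
\<close>

lemma reachable_if_displacement_in_cone:
  assumes "q0 \<in> Aff" "q \<in> Aff" "displacement q0 q \<in> K"
    and cone: "\<And>r u. 0 < r \<Longrightarrow> u \<in> K \<Longrightarrow> r *\<^sub>R u \<in> K"
  shows "q \<in> reachable K q0"
proof -
  define \<gamma> where "\<gamma> t = q0 + t *\<^sub>R (q - q0)" for t
  have pos: "0 < snd (\<gamma> t)" if "t \<in> {0..1}" for t
  proof -
    have "snd (\<gamma> t) = (1 - t) * snd q0 + t * snd q"
      by (simp add: \<gamma>_def algebra_simps)
    also have "\<dots> > 0"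
    proof (cases "t = 1")
      case False
      then show ?thesis
        using assms that by (intro add_pos_nonneg) (auto simp: Aff_def)
    qed (use assms in \<open>auto simp: Aff_def\<close>)
    finally show ?thesis .
  qed
  have "admissible_curve K 1 \<gamma>"
    unfolding admissible_curve_def
  proof (intro conjI)
    show "\<gamma> ` {0..1} \<subseteq> Aff"
      using pos by (auto simp: Aff_iff simp del: atLeastAtMost_iff)
    have "(norm (q - q0))-lipschitz_on {0..1} \<gamma>"
      by (intro lipschitz_onI) (auto simp: \<gamma>_def dist_norm mult.commute simp flip: scaleR_left_diff_distrib)
    then show "\<exists>L. L-lipschitz_on {0..1} \<gamma>" ..
    have "\<exists>u\<in>K. (\<gamma> has_vector_derivative lie_field u (\<gamma> t)) (at t within {0..1})"
      if "t \<in> {0..1}" for t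
    proof
      show "(1 / snd (\<gamma> t)) *\<^sub>R displacement q0 q \<in> K"
        using cone pos[OF that] assms(3) by simp
      have "lie_field ((1 / snd (\<gamma> t)) *\<^sub>R displacement q0 q) (\<gamma> t) = q - q0"
        using pos[OF that] by (simp add: lie_field_eq displacement_def prod_eq_iff)
      moreover have "(\<gamma> has_vector_derivative q - q0) (at t within {0..1})"
        unfolding \<gamma>_def by (auto intro!: derivative_eq_intros)
      ultimately show "(\<gamma> has_vector_derivative
          lie_field ((1 / snd (\<gamma> t)) *\<^sub>R displacement q0 q) (\<gamma> t)) (at t within {0..1})"
        by simp
    qed
    then show "AE t in lebesgue. t \<in> {0..1} \<longrightarrow>
      (\<exists>u\<in>K. (\<gamma> has_vector_derivative lie_field u (\<gamma> t)) (at t within {0..1}))"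
      by simp
  qed simp
  moreover have "\<gamma> 0 = q0" "\<gamma> 1 = q"
    by (auto simp: \<gamma>_def)
  ultimately show ?thesis
    unfolding reachable_def by blast
qed

section \<open>Linear functionals along admissible curves\<close>

lemma lipschitz_on_inner_right:
  assumes "L-lipschitz_on S q"
  shows "(norm w * L)-lipschitz_on S (\<lambda>t. w \<bullet> q t)"
proof (rule lipschitz_onI)
  fix s t assume "s \<in> S" "t \<in> S"
  have "dist (w \<bullet> q s) (w \<bullet> q t) = \<bar>w \<bullet> (q s - q t)\<bar>"
    by (simp add: dist_real_def inner_diff_right)
  also have "\<dots> \<le> norm w * norm (q s - q t)"
    by (rule Cauchy_Schwarz_ineq2)
  also have "\<dots> \<le> norm w * (L * dist s t)"
    using lipschitz_onD[OF assms \<open>s \<in> S\<close> \<open>t \<in> S\<close>] by (intro mult_left_mono) (auto simp: dist_norm)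
  finally show "dist (w \<bullet> q s) (w \<bullet> q t) \<le> norm w * L * dist s t"
    by (simp add: mult.assoc)
qed (use lipschitz_on_nonneg[OF assms] in simp)

text \<open>
  The factor \<open>y\<close> is the ordinate of the moving point. Only its sign matters: the functional is
  monotone along the curve as soon as it has one sign on the cone.
\<close>

lemma admissible_curve_functional:
  assumes "admissible_curve K T q"
  obtains L N where "L-lipschitz_on {0..T} (\<lambda>t. w \<bullet> q t)" "negligible N"
    "\<And>t. t \<in> {0..T} - N \<Longrightarrow> \<exists>u\<in>K. \<exists>y>0.
      ((\<lambda>t. w \<bullet> q t) has_real_derivative y * (w \<bullet> (u $ 1, u $ 2))) (at t within {0..T})"
proof -
  let ?P = "\<lambda>t. t \<in> {0..T} \<longrightarrow>
      (\<exists>u\<in>K. (q has_vector_derivative lie_field u (q t)) (at t within {0..T}))"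
  obtain L where L: "L-lipschitz_on {0..T} q"
    using assms by (auto simp: admissible_curve_def)
  have "AE t in lebesgue. ?P t"
    using assms by (simp add: admissible_curve_def)
  then obtain N where N: "N \<in> null_sets lebesgue" "{t \<in> space lebesgue. \<not> ?P t} \<subseteq> N"
    by (auto simp: eventually_ae_filter)
  show ?thesis
  proof (rule that)
    show "(norm w * L)-lipschitz_on {0..T} (\<lambda>t. w \<bullet> q t)"
      using L by (rule lipschitz_on_inner_right)
    show "negligible N"
      using N(1) by (simp add: negligible_iff_null_sets)
    fix t assume t: "t \<in> {0..T} - N"
    then obtain u where u: "u \<in> K" "(q has_vector_derivative lie_field u (q t)) (at t within {0..T})"
      using N(2) by auto
    have "((\<lambda>t. w \<bullet> q t) has_real_derivative snd (q t) * (w \<bullet> (u $ 1, u $ 2))) (at t within {0..T})"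
      using bounded_linear.has_vector_derivative[OF bounded_linear_inner_right u(2), of w]
      unfolding has_real_derivative_iff_has_vector_derivative lie_field_eq inner_scaleR_right .
    moreover have "0 < snd (q t)"
      using assms t by (auto simp: admissible_curve_def image_subset_iff Aff_iff)
    ultimately show "\<exists>u\<in>K. \<exists>y>0.
      ((\<lambda>t. w \<bullet> q t) has_real_derivative y * (w \<bullet> (u $ 1, u $ 2))) (at t within {0..T})"
      using u(1) by blast
  qed
qed

lemma admissible_curve_functional_le:
  assumes "admissible_curve K T q" and nonpos: "\<And>u. u \<in> K \<Longrightarrow> w \<bullet> (u $ 1, u $ 2) \<le> 0"
  shows "w \<bullet> q T \<le> w \<bullet> q 0"
proof -
  have "0 \<le> T" using assms(1) by (simp add: admissible_curve_def)
  obtain L N where *: "L-lipschitz_on {0..T} (\<lambda>t. w \<bullet> q t)" "negligible N"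
    "\<And>t. t \<in> {0..T} - N \<Longrightarrow> \<exists>u\<in>K. \<exists>y>0.
      ((\<lambda>t. w \<bullet> q t) has_real_derivative y * (w \<bullet> (u $ 1, u $ 2))) (at t within {0..T})"
    using admissible_curve_functional[OF assms(1)] by metis
  show ?thesis
    by (rule lipschitz_nonincreasing_if_deriv_nonpos_ae[OF \<open>0 \<le> T\<close> *(1,2)])
      (use *(3) nonpos in \<open>meson less_imp_le mult_nonneg_nonpos\<close>)
qed

lemma admissible_curve_functional_less:
  assumes "admissible_curve K T q" "0 < T" and neg: "\<And>u. u \<in> K \<Longrightarrow> w \<bullet> (u $ 1, u $ 2) < 0"
  shows "w \<bullet> q T < w \<bullet> q 0"
proof -
  obtain L N where *: "L-lipschitz_on {0..T} (\<lambda>t. w \<bullet> q t)" "negligible N"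
    "\<And>t. t \<in> {0..T} - N \<Longrightarrow> \<exists>u\<in>K. \<exists>y>0.
      ((\<lambda>t. w \<bullet> q t) has_real_derivative y * (w \<bullet> (u $ 1, u $ 2))) (at t within {0..T})"
    using admissible_curve_functional[OF assms(1)] by metis
  show ?thesis
    by (rule lipschitz_decreasing_if_deriv_neg_ae[OF \<open>0 < T\<close> *(1,2)])
      (use *(3) neg in \<open>meson mult_pos_neg\<close>)
qed

section \<open>Future and past\<close>

definition grad1 :: "real^2^2 \<Rightarrow> real \<times> real"
  where "grad1 A = (A $ 2 $ 1 - A $ 1 $ 1, A $ 2 $ 2 - A $ 1 $ 2)"

definition grad2 :: "real^2^2 \<Rightarrow> real \<times> real"
  where "grad2 A = (A $ 2 $ 1 + A $ 1 $ 1, A $ 2 $ 2 + A $ 1 $ 2)"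

lemma lambda_eq_inner:
  "lambda1 A q = grad1 A \<bullet> q - (A $ 2 $ 2 - A $ 1 $ 2)"
  "lambda2 A q = grad2 A \<bullet> q - (A $ 2 $ 2 + A $ 1 $ 2)"
  by (auto simp: lambda1_def lambda2_def grad1_def grad2_def inner_prod_def algebra_simps)

lemma grad_nonzero:
  assumes "det A \<noteq> 0"
  shows "grad1 A \<noteq> 0" "grad2 A \<noteq> 0"
  using assms by (auto simp: grad1_def grad2_def det_2 zero_prod_def add_eq_0_iff)

lemma future_nonspacelike_iff_grad:
  "u \<in> future_nonspacelike A \<longleftrightarrow> grad1 A \<bullet> (u $ 1, u $ 2) \<le> 0 \<and> 0 \<le> grad2 A \<bullet> (u $ 1, u $ 2)"
  by (auto simp: future_nonspacelike_def grad1_def grad2_def matrix_vector_mult_def sum_2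
      inner_prod_def algebra_simps abs_le_iff)

lemma future_timelike_iff_grad:
  "u \<in> future_timelike A \<longleftrightarrow> grad1 A \<bullet> (u $ 1, u $ 2) < 0 \<and> 0 < grad2 A \<bullet> (u $ 1, u $ 2)"
  by (auto simp: future_timelike_def grad1_def grad2_def matrix_vector_mult_def sum_2
      inner_prod_def algebra_simps abs_less_iff)

lemma inner_displacement:
  "w \<bullet> (displacement q0 q $ 1, displacement q0 q $ 2) = w \<bullet> q - w \<bullet> q0"
  by (simp add: displacement_def inner_prod_def algebra_simps)

lemma displacement_nonspacelike_iff:
  "displacement q0 q \<in> future_nonspacelike A \<longleftrightarrow>
    lambda1 A q \<le> lambda1 A q0 \<and> lambda2 A q \<ge> lambda2 A q0"
  unfolding future_nonspacelike_iff_grad inner_displacement lambda_eq_inner by auto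

lemma displacement_timelike_iff:
  "displacement q0 q \<in> future_timelike A \<longleftrightarrow>
    lambda1 A q < lambda1 A q0 \<and> lambda2 A q > lambda2 A q0"
  unfolding future_timelike_iff_grad inner_displacement lambda_eq_inner by auto

lemma future_nonspacelike_cone:
  "0 < r \<Longrightarrow> u \<in> future_nonspacelike A \<Longrightarrow> r *\<^sub>R u \<in> future_nonspacelike A"
  by (simp add: future_nonspacelike_def matrix_vector_mult_scaleR abs_mult mult_left_mono)

lemma future_timelike_cone:
  "0 < r \<Longrightarrow> u \<in> future_timelike A \<Longrightarrow> r *\<^sub>R u \<in> future_timelike A"
  by (simp add: future_timelike_def matrix_vector_mult_scaleR abs_mult)

lemma reachable_subset_Aff: "reachable K q0 \<subseteq> Aff"
  by (fastforce simp: reachable_def admissible_curve_def)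

lemma J_plus_eq_displacement:
  assumes "q0 \<in> Aff"
  shows "J_plus A q0 = {q \<in> Aff. displacement q0 q \<in> future_nonspacelike A}"
proof (intro subset_antisym subsetI)
  fix q assume "q \<in> J_plus A q0"
  then obtain T \<gamma> where \<gamma>: "admissible_curve (future_nonspacelike A) T \<gamma>" "\<gamma> 0 = q0" "\<gamma> T = q"
    by (auto simp: J_plus_def reachable_def)
  have "grad1 A \<bullet> q \<le> grad1 A \<bullet> q0" "- grad2 A \<bullet> q \<le> - grad2 A \<bullet> q0"
    using admissible_curve_functional_le[OF \<gamma>(1), of "grad1 A"]
      admissible_curve_functional_le[OF \<gamma>(1), of "- grad2 A"]
    by (auto simp: \<gamma> future_nonspacelike_iff_grad)
  moreover have "q \<in> Aff"
    using \<open>q \<in> J_plus A q0\<close> reachable_subset_Aff unfolding J_plus_def by blast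
  ultimately show "q \<in> {q \<in> Aff. displacement q0 q \<in> future_nonspacelike A}"
    by (simp add: future_nonspacelike_iff_grad inner_displacement)
next
  fix q assume "q \<in> {q \<in> Aff. displacement q0 q \<in> future_nonspacelike A}"
  then show "q \<in> J_plus A q0"
    using reachable_if_displacement_in_cone[OF assms _ _ future_nonspacelike_cone]
    unfolding J_plus_def by blast
qed

lemma I_plus_eq_displacement:
  assumes "q0 \<in> Aff"
  shows "I_plus A q0 = {q0} \<union> {q \<in> Aff. displacement q0 q \<in> future_timelike A}"
proof (intro subset_antisym subsetI)
  fix q assume "q \<in> I_plus A q0"
  then obtain T \<gamma> where \<gamma>: "admissible_curve (future_timelike A) T \<gamma>" "\<gamma> 0 = q0" "\<gamma> T = q"
    by (auto simp: I_plus_def reachable_def)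
  show "q \<in> {q0} \<union> {q \<in> Aff. displacement q0 q \<in> future_timelike A}"
  proof (cases "T = 0")
    case False
    then have "0 < T"
      using \<gamma>(1) by (simp add: admissible_curve_def)
    then have "grad1 A \<bullet> q < grad1 A \<bullet> q0" "- grad2 A \<bullet> q < - grad2 A \<bullet> q0"
      using admissible_curve_functional_less[OF \<gamma>(1), of "grad1 A"]
        admissible_curve_functional_less[OF \<gamma>(1), of "- grad2 A"]
      by (auto simp: \<gamma> future_timelike_iff_grad)
    moreover have "q \<in> Aff"
      using \<open>q \<in> I_plus A q0\<close> reachable_subset_Aff unfolding I_plus_def by blast
    ultimately show ?thesis
      by (simp add: future_timelike_iff_grad inner_displacement)
  qed (use \<gamma> in simp)
next
  \<comment> \<open>The zero vector is not timelike, so the base point needs the curve of duration 0.\<close>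
  have "AE t in lebesgue. t \<notin> {0::real}"
    by (rule AE_not_in) (simp flip: negligible_iff_null_sets)
  then have vacuous: "AE t in lebesgue. t \<in> {0..0::real} \<longrightarrow> P t" for P
    by (rule eventually_mono) simp
  have "admissible_curve (future_timelike A) 0 (\<lambda>t. q0)"
    unfolding admissible_curve_def
  proof (intro conjI)
    show "\<exists>L. L-lipschitz_on {0..0::real} (\<lambda>t. q0)"
      using lipschitz_on_constant by blast
  qed (use assms vacuous in \<open>auto simp del: atLeastAtMost_singleton\<close>)
  then have "q0 \<in> I_plus A q0"
    by (auto simp: I_plus_def reachable_def)
  moreover fix q assume "q \<in> {q0} \<union> {q \<in> Aff. displacement q0 q \<in> future_timelike A}"
  ultimately show "q \<in> I_plus A q0"
    using reachable_if_displacement_in_cone[OF assms _ _ future_timelike_cone]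
    unfolding I_plus_def by blast
qed

text \<open>
  The closed set is an intersection of half-planes bounded by genuine lines, the half-plane
  \<open>y > 0\<close> being open; interiors commute with finite intersections.
\<close>

lemma interior_displacement_nonspacelike:
  assumes "det A \<noteq> 0"
  shows "interior {q \<in> Aff. displacement q0 q \<in> future_nonspacelike A}
    = {q \<in> Aff. displacement q0 q \<in> future_timelike A}"
proof -
  have "Aff = UNIV \<times> {0<..}"
    by (auto simp: Aff_def)
  then have "interior Aff = Aff"
    by (metis interior_open open_Times open_UNIV open_greaterThan)
  moreover have "{q \<in> Aff. displacement q0 q \<in> future_nonspacelike A} = Aff \<inter>
      ({q. grad1 A \<bullet> q \<le> grad1 A \<bullet> q0} \<inter> {q. grad2 A \<bullet> q \<ge> grad2 A \<bullet> q0})"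
    by (auto simp: future_nonspacelike_iff_grad inner_displacement)
  ultimately have "interior {q \<in> Aff. displacement q0 q \<in> future_nonspacelike A} = Aff \<inter>
      ({q. grad1 A \<bullet> q < grad1 A \<bullet> q0} \<inter> {q. grad2 A \<bullet> q > grad2 A \<bullet> q0})"
    using grad_nonzero[OF assms] by (simp add: interior_halfspace_le interior_halfspace_ge)
  then show ?thesis
    by (auto simp: future_timelike_iff_grad inner_displacement)
qed

lemma future_characterisation:
  assumes "det A \<noteq> 0" "q0 \<in> Aff"
  shows "J_plus A q0 = aff_mult q0 ` aff_exp ` future_nonspacelike A"
    and "J_plus A q0 = {q \<in> Aff. lambda1 A q \<le> lambda1 A q0 \<and> lambda2 A q \<ge> lambda2 A q0}"
    and "I_plus A q0 = {q0} \<union> interior (J_plus A q0)"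
  using left_translate_exp_cone[OF assms(2) future_nonspacelike_cone]
    I_plus_eq_displacement[OF assms(2)] interior_displacement_nonspacelike[OF assms(1)]
  by (simp_all add: J_plus_eq_displacement[OF assms(2)] flip: displacement_nonspacelike_iff)

lemma matrix_vector_mult_uminus_left: "(- A) *v u = - (A *v u)" for A :: "real^2^2"
  by (simp add: matrix_vector_mult_def vec_eq_iff sum_negf)

lemma matrix_vector_mult_uminus_right: "A *v (- u) = - (A *v u)" for A :: "real^2^2"
  by (simp add: matrix_vector_mult_def vec_eq_iff sum_negf)

text \<open>
  Changing the sign of \<open>A\<close> leaves the Lorentzian form unchanged and reverses time, so that the
  statements about the past are those about the future for \<open>- A\<close>.
\<close>

lemma future_uminus:
  "future_nonspacelike (- A) = uminus ` future_nonspacelike A"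
  "future_timelike (- A) = uminus ` future_timelike A"
proof -
  have uminus_image: "uminus ` S = {u. - u \<in> S}" for S :: "(real^2) set"
    by force
  show "future_nonspacelike (- A) = uminus ` future_nonspacelike A"
    "future_timelike (- A) = uminus ` future_timelike A"
    unfolding uminus_image future_nonspacelike_def future_timelike_def
    by (simp_all add: matrix_vector_mult_uminus_left matrix_vector_mult_uminus_right)
qed

lemma lambda_uminus: "lambda1 (- A) q = - lambda1 A q" "lambda2 (- A) q = - lambda2 A q"
  by (auto simp: lambda1_def lambda2_def algebra_simps)

lemma plus_uminus: "J_plus (- A) = J_minus A" "I_plus (- A) = I_minus A"
  by (auto simp: fun_eq_iff J_plus_def J_minus_def I_plus_def I_minus_def future_uminus)

lemma det_uminus_2: "det (- A) = det A" for A :: "real^2^2"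
  by (simp add: det_2)

theorem theorem5:
  fixes A :: "real^2^2" and q0 :: "real \<times> real"
  assumes "det A > 0" and "q0 \<in> Aff"
  shows
    "J_plus A q0 = aff_mult q0 ` aff_exp ` future_nonspacelike A \<and>
     J_plus A q0 = {q \<in> Aff. lambda1 A q \<le> lambda1 A q0 \<and> lambda2 A q \<ge> lambda2 A q0} \<and>
     J_minus A q0 = aff_mult q0 ` aff_exp ` uminus ` future_nonspacelike A \<and>
     J_minus A q0 = {q \<in> Aff. lambda1 A q \<ge> lambda1 A q0 \<and> lambda2 A q \<le> lambda2 A q0} \<and>
     I_plus A q0 = {q0} \<union> interior (J_plus A q0) \<and>
     I_minus A q0 = {q0} \<union> interior (J_minus A q0)"
proof -
  have det: "det A \<noteq> 0" "det (- A) \<noteq> 0"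
    using assms(1) by (auto simp: det_uminus_2)
  note future = future_characterisation[OF det(1) assms(2)]
  note past = future_characterisation[OF det(2) assms(2),
      unfolded plus_uminus future_uminus lambda_uminus neg_le_iff_le]
  show ?thesis
    by (intro conjI) (fact future past)+
qed

end
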